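(* Let $0<\lambda\le\Lambda<\infty$, let $V_\infty>0$ be a constant, and let $f:\mathbf{R}\to\mathbf{R}$ satisfy: (f1) $f\in C^1(\mathbf{R})$ and $f(s)=0$ for all $s\le 0$; (f2) there exists $\eta_0>0$ such that $\lim_{s\to 0^+}s^{-1-\eta_0}f(s)=0$; (f3) as $s\to\infty$, $f(s)/s\to\infty$, and there is a function $\bar f:(0,1]\to\mathbf{R}$ such that $f(\theta s)/f(s)\to\bar f(\theta)$ uniformly for $\theta$ in compact subsets of $(0,1]$; (f4) $s\mapsto s^{-1}f(s)$ is strictly increasing on $(0,\infty)$. Then each of the two problems (one for the sign $+$, one for the sign $-$) $$-\mathcal{M}^{\pm}_{\lambda,\Lambda}(u'')+V_\infty u=f(u)\ \text{ in }\mathbf{R},\quad u>0\ \text{ in }\mathbf{R},\quad u(x)\to 0\ \text{ as }|x|\to\infty,\quad u(0)=\max_{x\in\mathbf{R}}u(x)$$ has a unique solution, denoted $\omega_+$ and $\omega_-$ respectively. Furthermore, there exist $z^{+},z^{-}>0$, $c_1>0$ and $c_2>0$ such that, for each sign, $$\omega_\pm''(x)<0=\omega_\pm''(z^\pm)<\omega_\pm''(y)\quad\text{for every }x,y\in\mathbf{R}\text{ with }|x|<z^\pm<|y|,$$ $$\omega_\pm(x)\le c_1\exp(-c_2|x|)\quad\text{for all }x\in\mathbf{R}.$$ Finally, for each sign, if $u$ satisfies $$-\mathcal{M}^{\pm}_{\lambda,\Lambda}(u'')+V_\infty u=f(u)\ \text{ in }\mathbf{R},\quad u>0\ \text{ in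 }\mathbf{R},\quad u(0)=\max_{\mathbf{R}}u,$$ and $u(x)\to 0$ as $x\to\infty$ or $u(x)\to 0$ as $x\to-\infty$, then $u=\omega_\pm$.
   Context: For $0<\lambda\le\Lambda<\infty$ the Pucci operators are the functions on $\mathbf{R}$ given by $\mathcal{M}^+_{\lambda,\Lambda}(s)=\Lambda s$ if $s\ge 0$ and $\lambda s$ if $s<0$; $\mathcal{M}^-_{\lambda,\Lambda}(s)=\lambda s$ if $s\ge 0$ and $\Lambda s$ if $s<0$. A solution is a classical one: $u\in C^2(\mathbf{R})$ and the equation holds at every point. *)

theory Defs
  imports "HOL-Analysis.Analysis"
begin

definition pucci_plus :: "real \<Rightarrow> real \<Rightarrow> real \<Rightarrow> real"
  where "pucci_plus lam Lam s = (if s \<ge> 0 then Lam * s else lam * s)"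

definition pucci_minus :: "real \<Rightarrow> real \<Rightarrow> real \<Rightarrow> real"
  where "pucci_minus lam Lam s = (if s \<ge> 0 then lam * s else Lam * s)"

definition C2_on_reals :: "(real \<Rightarrow> real) \<Rightarrow> bool"
  where "C2_on_reals u \<longleftrightarrow> u C1_differentiable_on UNIV \<and> deriv u C1_differentiable_on UNIV"

text \<open>
  Positive classical solutions of \<open>- M (u'') + V u = f u\<close> on the real line whose maximum
  is attained at the origin, without any condition at infinity.
\<close>
definition pos_solution_max_at_0 ::
    "(real \<Rightarrow> real) \<Rightarrow> real \<Rightarrow> (real \<Rightarrow> real) \<Rightarrow> (real \<Rightarrow> real) \<Rightarrow> bool"
  where "pos_solution_max_at_0 M V f u \<longleftrightarrow>
    C2_on_reals u \<and>
    (\<forall>x. - M (deriv (deriv u) x) + V * u x = f (u x)) \<and>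
    (\<forall>x. u x > 0) \<and>
    (\<forall>x. u x \<le> u 0)"

end

theory Submission
  imports Defs
begin

text \<open>
  Inverting the Pucci operator turns the equation into \<open>u'' = h u\<close> with \<open>h s = s * p s\<close> and \<open>p\<close>
  strictly decreasing through zero. Let \<open>H\<close> be the antiderivative of \<open>h\<close> with \<open>H 0 = 0\<close>; on the
  positive axis it has exactly one zero \<open>T\<close>, and it is positive before \<open>T\<close> and negative after it.
  The energy \<open>u'\<^sup>2 - 2 * H u\<close> is constant, so decay in a single direction forces energy zero, hence
  \<open>u 0 = T\<close> and \<open>u' 0 = 0\<close>; uniqueness is then uniqueness for the initial value problem.
  Existence comes from solving \<open>u'\<^sup>2 = 2 * H u\<close> by separation of variables, the concavity change from
  the sign of \<open>h\<close> along the strictly decreasing profile, and the exponential decay from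
  \<open>2 * H s \<ge> c\<^sup>2 * s\<^sup>2\<close> for small \<open>s\<close>.
\<close>

section \<open>Newton equations on the line\<close>

text \<open>Extended endpoints let one lemma serve both the time function on a bounded interval and
  the potential on the whole line.\<close>

lemma antiderivative_einterval:
  fixes g :: "real \<Rightarrow> real" and a b :: ereal and c :: real
  assumes "a < c" "c < b" "\<And>x. a < ereal x \<Longrightarrow> ereal x < b \<Longrightarrow> isCont g x"
  obtains G where "\<And>x. a < ereal x \<Longrightarrow> ereal x < b \<Longrightarrow> (G has_real_derivative g x) (at x)" "G c = 0"
proof -
  obtain F where F: "\<And>x. a < ereal x \<Longrightarrow> ereal x < b \<Longrightarrow> (F has_real_derivative g x) (at x)"
    using einterval_antiderivative[of a b g] assms less_trans[OF assms(1,2)]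
    by (auto simp: has_real_derivative_iff_has_vector_derivative)
  show ?thesis
    by (rule that[of "\<lambda>x. F x - F c"]) (auto intro!: derivative_eq_intros F)
qed

text \<open>The difference quotient of the square factors through \<open>v y + v x\<close>, which is
  nonzero near \<open>x\<close> by continuity. This gives the derivative of a velocity known to be
  continuous, from the energy identity for its square.\<close>

lemma DERIV_from_square:
  fixes v :: "real \<Rightarrow> real"
  assumes D: "((\<lambda>x. (v x)\<^sup>2) has_real_derivative 2 * v x * d) (at x)"
    and c: "isCont v x" and nz: "v x \<noteq> 0"
  shows "(v has_real_derivative d) (at x)"
proof -
  have v: "(v \<longlongrightarrow> v x) (at x)" using c by (simp add: isCont_def)
  have "((\<lambda>y. ((v y)\<^sup>2 - (v x)\<^sup>2) / (y - x) / (v y + v x)) \<longlongrightarrow> (2 * v x * d) / (v x + v x)) (at x)"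
    using D v nz by (intro tendsto_divide tendsto_add) (auto simp: has_field_derivative_iff)
  moreover have "eventually (\<lambda>y. v y + v x \<noteq> 0) (at x)"
    using tendsto_imp_eventually_ne[OF tendsto_add[OF v tendsto_const]] nz by fastforce
  ultimately have "((\<lambda>y. (v y - v x) / (y - x)) \<longlongrightarrow> (2 * v x * d) / (v x + v x)) (at x)"
    by (elim Lim_transform_eventually eventually_mono)
       (auto simp: power2_eq_square square_diff_square_factored)
  moreover have "(2 * v x * d) / (v x + v x) = d" using nz by (simp add: field_simps)
  ultimately show ?thesis by (simp add: has_field_derivative_iff)
qed

text \<open>Since \<open>h T < 0\<close>, the zero \<open>T\<close> of \<open>H\<close> is simple,
  so the orbit turns around there. The quadratic bound on \<open>H\<close> prevents the orbit from
  reaching 0 in finite time, so the profile exists and stays positive on the whole line.\<close>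

lemma homoclinic_exists:
  fixes h H :: "real \<Rightarrow> real" and T C :: real
  assumes H: "\<And>x. (H has_real_derivative h x) (at x)"
    and T: "0 < T" "H T = 0" "h T < 0" and Hpos: "\<And>s. 0 < s \<Longrightarrow> s < T \<Longrightarrow> 0 < H s"
    and C: "0 < C" "\<And>s. 0 < s \<Longrightarrow> s < T \<Longrightarrow> 2 * H s \<le> C * s\<^sup>2"
  obtains w v where "\<And>x. (w has_real_derivative v x) (at x)"
    "\<And>x. (v has_real_derivative h (w x)) (at x)"
    "\<And>x. 0 < w x" "w 0 = T" "\<And>x. (v x)\<^sup>2 = 2 * H (w x)" "\<And>x. w (- x) = w x"
    "\<And>x y. 0 \<le> x \<Longrightarrow> x < y \<Longrightarrow> w y < w x" "\<And>x. 0 < x \<Longrightarrow> v x < 0"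
    "\<And>s. 0 < s \<Longrightarrow> s \<le> T \<Longrightarrow> \<exists>x\<ge>0. w x = s"
proof -
  \<comment> \<open>In terms of \<open>r\<close> with \<open>w = T - r\<^sup>2\<close>, the equation \<open>w'\<^sup>2 = 2 * H w\<close> reads \<open>r' = k r\<close> with \<open>k\<close> continuous
    and positive on all of \<open>(-R, R)\<close>: the square-root singularity at the maximum of \<open>w\<close> is gone.\<close>
  define R where "R = sqrt T"
  have R: "0 < R" "R\<^sup>2 = T" using T by (auto simp: R_def)
  define D where "D = sqrt C"
  have D: "0 < D" "D\<^sup>2 = C" using C by (auto simp: D_def)
  have sqR: "r\<^sup>2 < T" if "- R < r" "r < R" for r
    using that R by (metis abs_less_iff abs_le_square_iff abs_of_pos not_less minus_less_iff)
  \<comment> \<open>Caratheodory's form of the derivative: \<open>q\<close> is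
    \<open>H z / (z - T)\<close>, extended continuously to \<open>T\<close> by the value
    \<open>h T\<close>.\<close>
  obtain q where q: "\<And>z. H z - H T = q z * (z - T)" and qc: "isCont q T" and qT: "q T = h T"
    using H[of T] unfolding CARAT_DERIV by blast
  have q_neg: "q z < 0" if "0 < z" "z \<le> T" for z
    using q[of z] Hpos[of z] that T qT by (cases "z = T") (auto simp: zero_less_mult_iff)
  have q_cont: "isCont q z" if "0 < z" for z
  proof (cases "z = T")
    case False
    have "isCont (\<lambda>z. H z / (z - T)) z"
      using False by (intro isCont_divide DERIV_isCont[OF H] continuous_intros) auto
    moreover have "eventually (\<lambda>y. y \<noteq> T) (nhds z)"
      using False by (simp add: t1_space_nhds)
    then have "eventually (\<lambda>y. q y = H y / (y - T)) (nhds z)"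
      by eventually_elim (use q T in \<open>auto simp: field_simps\<close>)
    ultimately show ?thesis by (simp add: isCont_cong)
  qed (use qc in simp)
  \<comment> \<open>With \<open>w = T - r\<^sup>2\<close> one has \<open>w' = - 2 * r * r'\<close>
    and \<open>2 * H w = - 2 * r\<^sup>2 * q w\<close>, so the energy equation becomes
    \<open>r'\<^sup>2 = - q w / 2\<close>.\<close>
  define k where "k r = sqrt (- q (T - r\<^sup>2) / 2)" for r
  have k_pos: "0 < k r" if "- R < r" "r < R" for r
    using q_neg[of "T - r\<^sup>2"] sqR[OF that] by (simp add: k_def)
  have k_sq: "(k r)\<^sup>2 = - q (T - r\<^sup>2) / 2" if "- R < r" "r < R" for r
    using q_neg[of "T - r\<^sup>2"] sqR[OF that] by (simp add: k_def)
  have k_H: "(2 * r * k r)\<^sup>2 = 2 * H (T - r\<^sup>2)" if "- R < r" "r < R" for r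
    using k_sq[OF that] q[of "T - r\<^sup>2"] T by (simp add: power_mult_distrib)
  have k_cont: "isCont k r" if "- R < r" "r < R" for r
  proof -
    have "isCont (\<lambda>r. q (T - r\<^sup>2)) r"
      by (rule isCont_o2[where g = q]) (use q_cont sqR[OF that] in \<open>auto intro!: continuous_intros\<close>)
    then show ?thesis unfolding k_def by (intro continuous_intros) auto
  qed
  have k_even: "k (- r) = k r" for r by (simp add: k_def)
  \<comment> \<open>\<open>P r\<close> is the time at which the orbit is at position
    \<open>r\<close>, with the maximum of \<open>w\<close> at time 0.\<close>
  obtain P where P: "\<And>r. - R < r \<Longrightarrow> r < R \<Longrightarrow> (P has_real_derivative 1 / k r) (at r)"
    and P0: "P 0 = 0"
  proof (rule antiderivative_einterval[of "ereal (- R)" 0 "ereal R" "\<lambda>r. 1 / k r"])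
    show "isCont (\<lambda>r. 1 / k r) r" if "ereal (- R) < ereal r" "ereal r < ereal R" for r
      using that k_pos[of r] k_cont[of r] by (intro continuous_intros) auto
  qed (use R in auto)
  have P_odd: "P (- r) = - P r" if "- R < r" "r < R" for r
  proof -
    have "((\<lambda>t. P (- t) + P t) has_real_derivative 0) (at t)" if "- R < t" "t < R" for t
      using DERIV_add[OF iffD1[OF DERIV_mirror P[of "- t"]] P[of t]] that by (simp add: k_even)
    then have "P (- r) + P r = P (- 0) + P 0"
      using that R by (intro DERIV_isconst3[where a = "-R" and b = R]) auto
    then show ?thesis using P0 by simp
  qed
  have P_mono: "P r < P s" if "- R < r" "r < s" "s < R" for r s
    by (rule DERIV_pos_imp_increasing[OF \<open>r < s\<close>])
       (meson P k_pos that less_le_trans le_less_trans zero_less_divide_1_iff)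
  \<comment> \<open>The bound on \<open>H\<close> says that \<open>w\<close> decreases at relative
    rate at most \<open>D\<close>, so descending from \<open>T\<close> to
    \<open>T - r\<^sup>2\<close> takes at least the time of an exponential decay with rate
    \<open>D\<close>.\<close>
  have P_large: "(ln T - ln (T - r\<^sup>2)) / D \<le> P r" if "0 \<le> r" "r < R" for r
  proof -
    have "P 0 + ln (T - 0\<^sup>2) / D \<le> P r + ln (T - r\<^sup>2) / D"
    proof (rule DERIV_nonneg_imp_nondecreasing[OF \<open>0 \<le> r\<close>])
      fix t assume t: "0 \<le> t" "t \<le> r"
      then have tR: "- R < t" "t < R" and t2: "t\<^sup>2 < T" using that sqR[of t] R by auto
      have "2 * t * k t \<le> D * (T - t\<^sup>2)"
      proof (cases "t = 0")
        case False
        have "(2 * t * k t)\<^sup>2 \<le> (D * (T - t\<^sup>2))\<^sup>2"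
          unfolding k_H[OF tR] using C(2)[of "T - t\<^sup>2"] t2 False D by (simp add: power_mult_distrib)
        then show ?thesis using t2 D by (simp add: power2_le_iff_abs_le)
      qed (use D T in simp)
      then have "0 \<le> 1 / k t + - (2 * t) / (T - t\<^sup>2) / D"
        using k_pos[OF tR] t2 D by (simp add: field_simps)
      moreover have "((\<lambda>r. P r + ln (T - r\<^sup>2) / D) has_real_derivative
          1 / k t + - (2 * t) / (T - t\<^sup>2) / D) (at t)"
        using t2 D by (auto intro!: derivative_eq_intros P tR)
      ultimately show "\<exists>y. ((\<lambda>r. P r + ln (T - r\<^sup>2) / D) has_real_derivative y) (at t) \<and> 0 \<le> y"
        by blast
    qed
    then show ?thesis using P0 by (simp add: diff_divide_distrib)
  qed
  have onto_pos: "\<exists>r. - R < r \<and> r < R \<and> P r = x" if "0 \<le> x" for x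
  proof -
    \<comment> \<open>\<open>e\<close> is the level an exponential decay with rate \<open>D\<close>
      reaches at time \<open>x\<close>. The orbit is at this level no earlier than \<open>x\<close>,
      so the intermediate value theorem applies on \<open>[0, s]\<close>.\<close>
    define e where "e = T * exp (- (D * x))"
    define s where "s = sqrt (T - e)"
    have e: "0 < e" "e \<le> T" using T D that by (auto simp: e_def mult_le_cancel_left1)
    have s: "0 \<le> s" "s < R" "s\<^sup>2 = T - e" using e by (auto simp: s_def R_def)
    have "ln e = ln T - D * x" using T by (simp add: e_def ln_mult)
    then have "x \<le> P s" using P_large[OF s(1,2)] s(3) D by simp
    moreover have "isCont P r" if "0 \<le> r \<and> r \<le> s" for r
      by (rule DERIV_isCont[OF P]) (use that s R in auto)
    ultimately obtain r where "0 \<le> r" "r \<le> s" "P r = x"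
      using IVT[of P 0 x s] P0 \<open>0 \<le> x\<close> s by auto
    then show ?thesis using s R by (intro exI[of _ r]) auto
  qed
  have "\<exists>r. - R < r \<and> r < R \<and> P r = x" for x
  proof (cases "0 \<le> x")
    case False
    then obtain r where "- R < r" "r < R" "P r = - x" using onto_pos[of "- x"] by auto
    then show ?thesis using P_odd[of r] by (intro exI[of _ "- r"]) auto
  qed (rule onto_pos)
  then obtain r where r: "\<And>x. - R < r x" "\<And>x. r x < R" "\<And>x. P (r x) = x"
    by metis
  have r_P: "r (P s) = s" if "- R < s" "s < R" for s
    using P_mono[of s "r (P s)"] P_mono[of "r (P s)" s] r that by (metis less_irrefl linorder_neqE)
  have r_mono: "r x < r y" if "x < y" for x y
    using P_mono[of "r y" "r x"] r that by (metis less_asym linorder_neqE)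
  have r0: "r 0 = 0" using r_P[of 0] R P0 by simp
  have r_odd: "r (- x) = - r x" for x
    using r_P[of "- r x"] P_odd[of "r x"] r[of x] by auto
  have r_deriv: "(r has_real_derivative k (r x)) (at x)" for x
    unfolding has_field_derivative_def
  proof (rule has_derivative_inverse_strong_x[where S = "{-R<..<R}" and f = P and f' = "(*) (1 / k (r x))"])
    show "continuous_on {-R<..<R} P"
      by (auto intro!: continuous_at_imp_continuous_on DERIV_isCont[OF P])
    show "(P has_derivative (*) (1 / k (r x))) (at (r x))"
      using P[of "r x"] r by (simp add: has_field_derivative_def)
  qed (use k_pos[of "r x"] r r_P in auto)
  define w where "w x = T - (r x)\<^sup>2" for x
  define v where "v x = - (2 * r x * k (r x))" for x
  have w_deriv: "(w has_real_derivative v x) (at x)" for x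
    unfolding w_def v_def by (auto intro!: derivative_eq_intros r_deriv)
  have v_sq: "(v x)\<^sup>2 = 2 * H (w x)" for x
    using k_H[of "r x"] r[of x] by (simp add: v_def w_def)
  have kr_cont: "isCont (\<lambda>x. k (r x)) x" for x
    by (rule isCont_o2[where g = k, OF DERIV_isCont[OF r_deriv]]) (use k_cont r in auto)
  have v_cont: "isCont v x" for x
    unfolding v_def by (intro continuous_intros kr_cont DERIV_isCont[OF r_deriv])
  have v_deriv: "(v has_real_derivative h (w x)) (at x)" for x
  \<comment> \<open>At 0 the velocity vanishes and cannot be cancelled from the differentiated
    energy identity. There \<open>r 0 = 0\<close> reduces the difference quotient of
    \<open>v\<close> to that of \<open>r\<close> times a continuous factor.\<close>
  proof (cases "x = 0")
    case True
    have "((\<lambda>y. - 2 * ((r y - r 0) / (y - 0)) * k (r y)) \<longlongrightarrow> - 2 * k (r 0) * k (r 0)) (at 0)"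
      using r_deriv[of 0] kr_cont[of 0]
      by (intro tendsto_intros) (auto simp: has_field_derivative_iff isCont_def)
    moreover have "- 2 * k (r 0) * k (r 0) = h (w 0)"
      using k_sq[of 0] R qT by (simp add: r0 w_def power2_eq_square)
    ultimately show ?thesis
      by (simp add: True has_field_derivative_iff v_def r0)
  next
    case False
    have "((\<lambda>x. 2 * H (w x)) has_real_derivative 2 * v x * h (w x)) (at x)"
      by (auto intro!: derivative_eq_intros DERIV_chain2[where f = H] H w_deriv)
    then have "((\<lambda>x. (v x)\<^sup>2) has_real_derivative 2 * v x * h (w x)) (at x)"
      by (simp add: v_sq)
    moreover have "r x \<noteq> 0" using False r_mono[of x 0] r_mono[of 0 x] r0 by linarith
    then have "v x \<noteq> 0" using k_pos[of "r x"] r[of x] by (simp add: v_def)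
    ultimately show ?thesis using DERIV_from_square v_cont by blast
  qed
  show thesis
  proof (rule that[of w v])
    show "0 < w x" for x using sqR[of "r x"] r by (simp add: w_def)
    show "w 0 = T" by (simp add: w_def r0)
    show "w (- x) = w x" for x by (simp add: w_def r_odd)
    show "w y < w x" if "0 \<le> x" "x < y" for x y
    proof -
      have "0 \<le> r x" using r_mono[of 0 x] r0 that by (cases "x = 0") auto
      then show ?thesis using r_mono[of x y] that by (simp add: w_def power_strict_mono)
    qed
    show "v x < 0" if "0 < x" for x
      using r_mono[of 0 x] r0 that k_pos[of "r x"] r[of x] by (simp add: v_def)
    show "\<exists>x\<ge>0. w x = s" if "0 < s" "s \<le> T" for s
    proof -
      have a: "0 \<le> sqrt (T - s)" "sqrt (T - s) < R" "- R < sqrt (T - s)"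
        using that R by (auto simp: R_def intro: less_le_trans[of _ 0])
      have "0 \<le> P (sqrt (T - s))"
        using P_mono[of 0 "sqrt (T - s)"] a P0 R by (cases "sqrt (T - s) = 0") auto
      then show ?thesis using r_P[OF a(3,2)] that by (intro exI[of _ "P (sqrt (T - s))"]) (auto simp: w_def)
    qed
  qed (use w_deriv v_deriv v_sq in auto)
qed

text \<open>A Gronwall argument: the squared distance \<open>e\<close> in the phase plane satisfies
  \<open>e' \<le> (1 + L) * e\<close> and vanishes at 0. The set \<open>S\<close> contains both
  orbits, so a Lipschitz constant on a bounded interval will do.\<close>

lemma newton_initial_value_unique_right:
  fixes u v w z h :: "real \<Rightarrow> real"
  assumes u: "\<And>x. (u has_real_derivative v x) (at x)" "\<And>x. (v has_real_derivative h (u x)) (at x)"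
    and w: "\<And>x. (w has_real_derivative z x) (at x)" "\<And>x. (z has_real_derivative h (w x)) (at x)"
    and L: "L-lipschitz_on S h" and S: "\<And>x. u x \<in> S" "\<And>x. w x \<in> S"
    and init: "u 0 = w 0" "v 0 = z 0" and x: "0 \<le> x"
  shows "u x = w x"
proof -
  define e where "e t = (u t - w t)\<^sup>2 + (v t - z t)\<^sup>2" for t
  have "exp (- (1 + L) * x) * e x \<le> exp (- (1 + L) * 0) * e 0"
  proof (rule DERIV_nonpos_imp_nonincreasing[OF x])
    fix t
    define a b d where "a = u t - w t" and "b = v t - z t" and "d = h (u t) - h (w t)"
    have L0: "0 \<le> L" using L by (rule lipschitz_on_nonneg)
    have "\<bar>d\<bar> \<le> L * \<bar>a\<bar>"
      using lipschitz_onD[OF L S] by (simp add: a_def d_def dist_real_def)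
    then have "b * d \<le> \<bar>b\<bar> * (L * \<bar>a\<bar>)"
      by (metis abs_ge_self abs_mult mult_left_mono abs_ge_zero order_trans)
    moreover have "2 * (a * b) \<le> a\<^sup>2 + b\<^sup>2" using sum_squares_bound[of a b] by simp
    moreover have "L * (2 * \<bar>a\<bar> * \<bar>b\<bar>) \<le> L * (a\<^sup>2 + b\<^sup>2)"
      using mult_left_mono[OF sum_squares_bound[of "\<bar>a\<bar>" "\<bar>b\<bar>"] L0] by simp
    ultimately have "2 * a * b + 2 * b * d \<le> (1 + L) * (a\<^sup>2 + b\<^sup>2)"
      by (simp add: algebra_simps)
    then have "exp (- (1 + L) * t) * (2 * a * b + 2 * b * d - (1 + L) * (a\<^sup>2 + b\<^sup>2)) \<le> 0"
      by (simp add: mult_le_0_iff)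
    moreover have "((\<lambda>t. exp (- (1 + L) * t) * e t) has_real_derivative
        exp (- (1 + L) * t) * (2 * a * b + 2 * b * d - (1 + L) * (a\<^sup>2 + b\<^sup>2))) (at t)"
      unfolding e_def a_def b_def d_def
      by (auto intro!: derivative_eq_intros u w) (simp add: algebra_simps)
    ultimately show "\<exists>y. ((\<lambda>t. exp (- (1 + L) * t) * e t) has_real_derivative y) (at t) \<and> y \<le> 0"
      by blast
  qed
  then have "e x \<le> 0" using init by (simp add: e_def mult_le_0_iff)
  then show ?thesis by (simp add: e_def sum_power2_le_zero_iff)
qed

text \<open>Time reversal: it carries results on the right half-line, and decay at plus infinity,
  over to the left.\<close>

lemma newton_reflect:
  fixes u v h :: "real \<Rightarrow> real"
  assumes "\<And>x. (u has_real_derivative v x) (at x)" "\<And>x. (v has_real_derivative h (u x)) (at x)"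
  shows "((\<lambda>x. u (- x)) has_real_derivative - v (- x)) (at x)"
    and "((\<lambda>x. - v (- x)) has_real_derivative h (u (- x))) (at x)"
  using assms DERIV_mirror DERIV_minus by (metis, metis minus_minus)

lemma newton_initial_value_unique:
  fixes u v w z h :: "real \<Rightarrow> real"
  assumes u: "\<And>x. (u has_real_derivative v x) (at x)" "\<And>x. (v has_real_derivative h (u x)) (at x)"
    and w: "\<And>x. (w has_real_derivative z x) (at x)" "\<And>x. (z has_real_derivative h (w x)) (at x)"
    and L: "L-lipschitz_on S h" and S: "\<And>x. u x \<in> S" "\<And>x. w x \<in> S"
    and init: "u 0 = w 0" "v 0 = z 0"
  shows "u = w"
proof
  fix x
  show "u x = w x"
  proof (cases "0 \<le> x")
    case False
    have "u (- (- x)) = w (- (- x))"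
      by (rule newton_initial_value_unique_right[OF newton_reflect[OF u] newton_reflect[OF w] L S])
         (use init False in auto)
    then show ?thesis by simp
  qed (rule newton_initial_value_unique_right[OF u w L S init])
qed

lemma energy_zero_if_decaying:
  fixes u v h H :: "real \<Rightarrow> real"
  assumes u: "\<And>x. (u has_real_derivative v x) (at x)" "\<And>x. (v has_real_derivative h (u x)) (at x)"
    and H: "\<And>x. (H has_real_derivative h x) (at x)" "H 0 = 0"
    and v0: "v 0 = 0" and lim: "(u \<longlongrightarrow> 0) at_top"
  shows "H (u 0) = 0"
proof -
  have "(v x)\<^sup>2 - 2 * H (u x) = (v 0)\<^sup>2 - 2 * H (u 0)" for x
    by (rule DERIV_isconst_all)
       (auto intro!: derivative_eq_intros u DERIV_chain2[where f = H] H)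
  then have energy: "(v x)\<^sup>2 = 2 * H (u x) - 2 * H (u 0)" for x
    using v0 by (simp add: algebra_simps)
  have "((\<lambda>x. H (u x)) \<longlongrightarrow> H 0) at_top"
    using isCont_tendsto_compose[OF DERIV_isCont[OF H(1)] lim] .
  then have v_lim: "((\<lambda>x. (v x)\<^sup>2) \<longlongrightarrow> - 2 * H (u 0)) at_top"
    unfolding energy using H(2) by (auto intro!: tendsto_eq_intros)
  \<comment> \<open>The energy makes \<open>v\<^sup>2\<close> converge, and the mean value theorem on \<open>[n, n + 1]\<close> shows that the limit is zero.\<close>
  have "\<exists>y. real n < y \<and> y < real n + 1 \<and> u (real n + 1) - u (real n) = v y" for n
    using MVT2[of "real n" "real n + 1" u v] u(1) by auto
  then obtain y where y: "\<And>n. real n < y n" "\<And>n. u (real n + 1) - u (real n) = v (y n)"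
    by metis
  have y_top: "filterlim y at_top sequentially"
    by (rule filterlim_at_top_mono[OF filterlim_real_sequentially]) (use y(1) in \<open>auto intro!: always_eventually less_imp_le\<close>)
  have "filterlim (\<lambda>n. real n + 1) at_top sequentially"
    by (rule filterlim_at_top_mono[OF filterlim_real_sequentially]) auto
  then have "(\<lambda>n. (u (real n + 1) - u (real n))\<^sup>2) \<longlonglongrightarrow> (0 - 0)\<^sup>2"
    by (intro tendsto_intros filterlim_compose[OF lim] filterlim_real_sequentially)
  then have "(\<lambda>n. (v (y n))\<^sup>2) \<longlonglongrightarrow> 0" by (simp add: y)
  moreover have "(\<lambda>n. (v (y n))\<^sup>2) \<longlonglongrightarrow> - 2 * H (u 0)"
    by (rule filterlim_compose[OF v_lim y_top])
  ultimately show ?thesis using LIMSEQ_unique by fastforce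
qed

lemma DERIV_zero_at_max:
  fixes u :: "real \<Rightarrow> real"
  assumes "(u has_real_derivative d) (at a)" "\<And>x. u x \<le> u a"
  shows "d = 0"
  using DERIV_local_max[OF assms(1), of 1] assms(2) by simp

section \<open>Ground states of scalar field equations\<close>

text \<open>On the positive axis \<open>p\<close> is the quotient \<open>h s / s\<close>. Its bound
  \<open>C\<close> yields the quadratic bound on the potential, and its sign change yields the
  inflection level of the profile.\<close>

locale scalar_field =
  fixes h p :: "real \<Rightarrow> real" and C :: real
  assumes h_cont: "continuous_on UNIV h"
    and h_lipschitz: "\<And>c. \<exists>L. L-lipschitz_on {0..c} h"
    and h_factor: "\<And>s. 0 < s \<Longrightarrow> h s = s * p s"
    and p_less: "\<And>s t. 0 < s \<Longrightarrow> s < t \<Longrightarrow> p t < p s"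
    and p_le: "\<And>s. 0 < s \<Longrightarrow> p s \<le> C"
    and p_pos: "\<exists>s>0. 0 < p s"
    and p_neg: "\<exists>s>0. p s < 0"
begin

lemma p_zero: obtains s where "0 < s" "p s = 0"
proof -
  obtain a b where ab: "0 < a" "0 < p a" "0 < b" "p b < 0" using p_pos p_neg by auto
  have "a < b" using ab p_less[of b a] by (cases a b rule: linorder_cases) auto
  \<comment> \<open>Continuity is available for \<open>h s / s\<close>, so the intermediate value
    theorem is applied to this quotient and the result transferred to \<open>p\<close>.\<close>
  have "isCont (\<lambda>s. h s / s) x" if "0 < x" for x
    using h_cont that by (intro continuous_intros) (auto simp: continuous_on_eq_continuous_at)
  then have "\<exists>s\<ge>a. s \<le> b \<and> h s / s = 0"
    using ab \<open>a < b\<close> by (intro IVT2) (auto simp: h_factor)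
  then obtain s where "a \<le> s" "h s / s = 0" by blast
  then show ?thesis using that[of s] ab h_factor[of s] by simp
qed

section \<open>Growth and sign of the potential\<close>

context
  fixes H :: "real \<Rightarrow> real"
  assumes H: "\<And>x. (H has_real_derivative h x) (at x)"
begin

lemma H_continuous: "continuous_on S H"
  by (rule DERIV_continuous_on, rule DERIV_subset[OF H]) auto

text \<open>The derivative of \<open>m * t\<^sup>2 - 2 * H t\<close> is
  \<open>2 * t * (m - p t)\<close>. The bound on \<open>p\<close> is asked only inside the interval,
  which admits \<open>a = 0\<close>.\<close>

lemma H_diff_le:
  assumes "0 \<le> a" "a \<le> b" "\<And>t. a < t \<Longrightarrow> t < b \<Longrightarrow> p t \<le> m"
  shows "2 * (H b - H a) \<le> m * (b\<^sup>2 - a\<^sup>2)"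
proof -
  have "m * a\<^sup>2 - 2 * H a \<le> m * b\<^sup>2 - 2 * H b"
  proof (rule DERIV_nonneg_imp_increasing_open[OF \<open>a \<le> b\<close>])
    fix t assume t: "a < t" "t < b"
    then have "0 \<le> 2 * (t * (m - p t))" using assms by simp
    then have "0 \<le> m * (2 * t) - 2 * h t" using t assms by (simp add: h_factor algebra_simps)
    moreover have "((\<lambda>t. m * t\<^sup>2 - 2 * H t) has_real_derivative m * (2 * t) - 2 * h t) (at t)"
      by (auto intro!: derivative_eq_intros H)
    ultimately show "\<exists>y. ((\<lambda>t. m * t\<^sup>2 - 2 * H t) has_real_derivative y) (at t) \<and> 0 \<le> y"
      by blast
  qed (intro continuous_intros H_continuous)
  then show ?thesis by (simp add: algebra_simps)
qed

lemma H_diff_ge: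
  assumes "0 \<le> a" "a \<le> b" "\<And>t. a < t \<Longrightarrow> t < b \<Longrightarrow> m \<le> p t"
  shows "m * (b\<^sup>2 - a\<^sup>2) \<le> 2 * (H b - H a)"
proof -
  have "2 * H a - m * a\<^sup>2 \<le> 2 * H b - m * b\<^sup>2"
  proof (rule DERIV_nonneg_imp_increasing_open[OF \<open>a \<le> b\<close>])
    fix t assume t: "a < t" "t < b"
    then have "0 \<le> 2 * (t * (p t - m))" using assms by simp
    then have "0 \<le> 2 * h t - m * (2 * t)" using t assms by (simp add: h_factor algebra_simps)
    moreover have "((\<lambda>t. 2 * H t - m * t\<^sup>2) has_real_derivative 2 * h t - m * (2 * t)) (at t)"
      by (auto intro!: derivative_eq_intros H)
    ultimately show "\<exists>y. ((\<lambda>t. 2 * H t - m * t\<^sup>2) has_real_derivative y) (at t) \<and> 0 \<le> y"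
      by blast
  qed (intro continuous_intros H_continuous)
  then show ?thesis by (simp add: algebra_simps)
qed

lemma H_strict_decreasing:
  assumes "0 < s" "p s = 0" "s \<le> a" "a < b"
  shows "H b < H a"
proof (rule DERIV_neg_imp_decreasing_open[OF \<open>a < b\<close> _ H_continuous])
  fix t assume t: "a < t" "t < b"
  then have "p t < 0" using p_less[of s t] assms by auto
  then have "h t < 0" using t assms h_factor[of t] by (simp add: mult_less_0_iff)
  then show "\<exists>y. (H has_real_derivative y) (at t) \<and> y < 0" using H by blast
qed

text \<open>\<open>H\<close> rises from 0 while \<open>p\<close> is positive, and beyond
  \<open>s + 1\<close> it falls at least quadratically because \<open>p\<close> stays below
  \<open>p (s + 1) < 0\<close>. Strict decrease after \<open>s\<close> makes the crossing
  unique.\<close>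

lemma potential_zero:
  assumes s: "0 < s" "p s = 0" and H0: "H 0 = 0"
  obtains T where "s < T" "H T = 0" "\<And>t. 0 < t \<Longrightarrow> t < T \<Longrightarrow> 0 < H t" "\<And>t. T < t \<Longrightarrow> H t < 0"
proof -
  have pos: "0 < H t" if "0 < t" "t \<le> s" for t
  proof -
    \<comment> \<open>Halving keeps the inequality strict up to \<open>t = s\<close>, where
      \<open>p\<close> vanishes: the first half contributes a positive amount and the second a
      nonnegative one.\<close>
    have "0 < p (t / 2) * ((t / 2)\<^sup>2 - 0\<^sup>2)"
      using p_less[of "t / 2" s] s that by (intro mult_pos_pos) auto
    also have "\<dots> \<le> 2 * (H (t / 2) - H 0)"
      by (rule H_diff_ge) (use that less_imp_le[OF p_less] in auto)
    finally have half: "0 < H (t / 2)" using H0 by simp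
    have "0 * (t\<^sup>2 - (t / 2)\<^sup>2) \<le> 2 * (H t - H (t / 2))"
    proof (rule H_diff_ge)
      show "0 \<le> p x" if "t / 2 < x" "x < t" for x
        using p_less[of x s] s that \<open>0 < t\<close> \<open>t \<le> s\<close> by simp
    qed (use that in auto)
    then show ?thesis using half by simp
  qed
  define m where "m = - p (s + 1)"
  have m: "0 < m" using p_less[of s "s + 1"] s by (simp add: m_def)
  \<comment> \<open>Since \<open>b + (s + 1) \<ge> 1\<close>, the difference of squares is at least
    \<open>b - (s + 1)\<close>. This \<open>b\<close> therefore makes \<open>H\<close> drop by at
    least \<open>\<bar>H (s + 1)\<bar>\<close>.\<close>
  define b where "b = s + 1 + 2 * \<bar>H (s + 1)\<bar> / m"
  have b: "s + 1 \<le> b" using m by (simp add: b_def)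
  have "2 * (H b - H (s + 1)) \<le> p (s + 1) * (b\<^sup>2 - (s + 1)\<^sup>2)"
    by (rule H_diff_le) (use s b in \<open>auto intro: less_imp_le[OF p_less]\<close>)
  then have "2 * (H b - H (s + 1)) \<le> - (m * (b\<^sup>2 - (s + 1)\<^sup>2))"
    by (simp add: m_def)
  moreover have "2 * \<bar>H (s + 1)\<bar> / m \<le> b\<^sup>2 - (s + 1)\<^sup>2"
  proof -
    have "(b - (s + 1)) * 1 \<le> (b - (s + 1)) * (b + (s + 1))"
      using b s by (intro mult_left_mono) auto
    then show ?thesis by (simp add: b_def power2_eq_square algebra_simps)
  qed
  then have "2 * \<bar>H (s + 1)\<bar> \<le> m * (b\<^sup>2 - (s + 1)\<^sup>2)" using m by (simp add: field_simps)
  ultimately have "2 * (H b - H (s + 1)) \<le> - (2 * \<bar>H (s + 1)\<bar>)" by simp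
  then have "H b \<le> 0" using abs_ge_self[of "H (s + 1)"] by simp
  then obtain T where T: "s \<le> T" "T \<le> b" "H T = 0"
    using IVT2[of H b 0 s] pos[of s] s b DERIV_isCont[OF H] by auto
  then have sT: "s < T" using pos[of s] s by (cases "s = T") auto
  show ?thesis
  proof (rule that[OF sT \<open>H T = 0\<close>])
    show "0 < H t" if "0 < t" "t < T" for t
      using pos[of t] H_strict_decreasing[OF s, of t T] that T by (cases "t \<le> s") auto
    show "H t < 0" if "T < t" for t
      using H_strict_decreasing[OF s, of T t] that T by auto
  qed
qed

end

text \<open>The equation is kept as a first-order system, and decay is left out so that it can be
  imposed in one direction only.\<close>

definition profile :: "(real \<Rightarrow> real) \<Rightarrow> bool" where
  "profile u \<longleftrightarrow> (\<exists>v. \<forall>x. (u has_real_derivative v x) (at x) \<and>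
     (v has_real_derivative h (u x)) (at x) \<and> 0 < u x \<and> u x \<le> u 0)"

proposition profile_exists_unique:
  obtains w z c1 c2 where "profile w" "0 < z" "0 < c1" "0 < c2"
    "\<And>x. \<bar>x\<bar> < z \<Longrightarrow> h (w x) < 0" "h (w z) = 0" "\<And>x. z < \<bar>x\<bar> \<Longrightarrow> 0 < h (w x)"
    "\<And>x. w x \<le> c1 * exp (- c2 * \<bar>x\<bar>)"
    "\<And>u. profile u \<Longrightarrow> (u \<longlongrightarrow> 0) at_top \<or> (u \<longlongrightarrow> 0) at_bot \<Longrightarrow> u = w"
proof -
  obtain s where s: "0 < s" "p s = 0" by (rule p_zero)
  obtain H where H: "\<And>x. (H has_real_derivative h x) (at x)" and H0: "H 0 = 0"
    using antiderivative_einterval[of "-\<infinity>" 0 "\<infinity>" h] h_cont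
    by (auto simp: continuous_on_eq_continuous_at)
  obtain T where T: "s < T" "H T = 0" and H_pos: "\<And>t. 0 < t \<Longrightarrow> t < T \<Longrightarrow> 0 < H t"
    and H_neg: "\<And>t. T < t \<Longrightarrow> H t < 0"
    using potential_zero[OF H s H0] by blast
  have h_pos: "0 < h t" if "0 < t" "t < s" for t
    using p_less[of t s] that s h_factor[of t] by simp
  have h_neg: "h t < 0" if "s < t" for t
    using p_less[of s t] that s h_factor[of t] by (simp add: mult_less_0_iff)
  have C: "0 < C" using p_pos p_le by force
  have H_le: "2 * H t \<le> C * t\<^sup>2" if "0 < t" for t
    using H_diff_le[OF H, of 0 t C] that p_le H0 by simp
  obtain w v where w: "\<And>x. (w has_real_derivative v x) (at x)"
      "\<And>x. (v has_real_derivative h (w x)) (at x)"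
    and w_pos: "\<And>x. 0 < w x" and w0: "w 0 = T" and v_sq: "\<And>x. (v x)\<^sup>2 = 2 * H (w x)"
    and w_even: "\<And>x. w (- x) = w x" and w_decr: "\<And>x y. 0 \<le> x \<Longrightarrow> x < y \<Longrightarrow> w y < w x"
    and v_neg: "\<And>x. 0 < x \<Longrightarrow> v x < 0" and w_onto: "\<And>t. 0 < t \<Longrightarrow> t \<le> T \<Longrightarrow> \<exists>x\<ge>0. w x = t"
  proof (rule homoclinic_exists[of H h T C])
    show "0 < T" using s T by simp
    show "2 * H t \<le> C * t\<^sup>2" if "0 < t" for t using H_le that .
  qed (use H T(2) h_neg[OF T(1)] H_pos C in blast)+
  have w_abs: "w x = w \<bar>x\<bar>" for x using w_even[of x] by (simp add: abs_if)
  have w_le: "w x \<le> T" for x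
    using w_decr[of 0 "\<bar>x\<bar>"] w_abs[of x] w0 by (cases "x = 0") auto
  have w_profile: "profile w" unfolding profile_def using w w_pos w_le w0 by auto
  \<comment> \<open>The concavity changes where the profile passes through the zero \<open>s\<close>
    of \<open>p\<close>; since \<open>s < T\<close>, this is away from the maximum.\<close>
  obtain z where z: "0 \<le> z" "w z = s" using w_onto[of s] s T by auto
  have z_pos: "0 < z" using z w0 T by (cases "z = 0") auto
  have h_w_neg: "h (w x) < 0" if "\<bar>x\<bar> < z" for x
    using w_decr[of "\<bar>x\<bar>" z] that z w_abs[of x] h_neg[of "w x"] by simp
  have h_w_pos: "0 < h (w x)" if "z < \<bar>x\<bar>" for x
    using w_decr[of z "\<bar>x\<bar>"] that z w_abs[of x] h_pos[of "w x"] w_pos[of x] by simp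
  \<comment> \<open>Below the level \<open>s / 2\<close> one has \<open>p \<ge> c\<^sup>2\<close>,
    hence \<open>2 * H w \<ge> c\<^sup>2 * w\<^sup>2\<close> and \<open>w' \<le> - c * w\<close> on
    the right half-line.\<close>
  define c where "c = sqrt (p (s / 2))"
  have p_half: "0 < p (s / 2)" using p_less[of "s / 2" s] s by simp
  then have c: "0 < c" "c\<^sup>2 = p (s / 2)" by (auto simp: c_def)
  obtain a where a: "0 \<le> a" "w a = s / 2" using w_onto[of "s / 2"] s T by auto
  \<comment> \<open>Up to \<open>a\<close> only \<open>w \<le> T\<close> is used, and the factor
    \<open>exp (c * a)\<close> compensates for the missing decay.\<close>
  define K where "K = T * exp (c * a)"
  have K: "0 < K" using T s by (simp add: K_def)
  have decay_pos: "w x \<le> K * exp (- c * x)" if "0 \<le> x" for x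
  proof (cases "x \<le> a")
    case True
    have "T * exp (c * x) \<le> K" using True c s T by (simp add: K_def)
    then have "w x * exp (c * x) \<le> K"
      using w_le[of x] by (smt (verit) mult_right_mono exp_ge_zero)
    then show ?thesis by (simp add: exp_minus field_simps)
  next
    case False
    have "w x * exp (c * x) \<le> w a * exp (c * a)"
    proof (rule DERIV_nonpos_imp_decreasing_open[where f = "\<lambda>t. w t * exp (c * t)"])
      show "a \<le> x" using False by simp
    next
      fix t assume t: "a < t" "t < x"
      then have wt: "w t < s / 2" using w_decr[of a t] a by simp
      have "p (s / 2) * ((w t)\<^sup>2 - 0\<^sup>2) \<le> 2 * (H (w t) - H 0)"
        by (rule H_diff_ge[OF H]) (use wt w_pos[of t] less_imp_le[OF p_less] in auto)
      then have "(c * w t)\<^sup>2 \<le> (- v t)\<^sup>2" using c H0 v_sq by (simp add: power_mult_distrib)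
      moreover have "0 \<le> - v t" using v_neg[of t] t a(1) by simp
      ultimately have "c * w t \<le> - v t" by (rule power2_le_imp_le)
      then have "(v t + c * w t) * exp (c * t) \<le> 0" by (simp add: mult_le_0_iff)
      moreover have "((\<lambda>t. w t * exp (c * t)) has_real_derivative (v t + c * w t) * exp (c * t)) (at t)"
        by (auto intro!: derivative_eq_intros w simp: algebra_simps)
      ultimately show "\<exists>y. ((\<lambda>t. w t * exp (c * t)) has_real_derivative y) (at t) \<and> y \<le> 0"
        by blast
    qed (auto intro!: continuous_at_imp_continuous_on continuous_intros DERIV_isCont[OF w(1)])
    also have "\<dots> \<le> K" using w_le[of a] by (simp add: K_def)
    finally show ?thesis by (simp add: exp_minus field_simps)
  qed
  have unique_top: "u = w" if u: "\<And>x. (u has_real_derivative v' x) (at x)"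
      "\<And>x. (v' has_real_derivative h (u x)) (at x)" "\<And>x. 0 < u x" "\<And>x. u x \<le> u 0"
    and lim: "(u \<longlongrightarrow> 0) at_top" for u v'
  proof -
    have v0: "v' 0 = 0" using DERIV_zero_at_max[OF u(1,4)] .
    have "H (u 0) = 0" by (rule energy_zero_if_decaying[OF u(1,2) H H0 v0 lim])
    then have u0: "u 0 = T"
      using H_pos[of "u 0"] H_neg[of "u 0"] u(3)[of 0] by (cases "u 0" T rule: linorder_cases) auto
    \<comment> \<open>Both solutions start at \<open>T\<close> with velocity zero, and maximality at
      0 confines them to \<open>[0, T]\<close>.\<close>
    obtain L where L: "L-lipschitz_on {0..T} h" using h_lipschitz by blast
    show ?thesis
    proof (rule newton_initial_value_unique[OF u(1,2) w L])
      show "u x \<in> {0..T}" for x using u(3,4)[of x] u0 by simp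
      show "w x \<in> {0..T}" for x using w_pos[of x] w_le[of x] by simp
      show "u 0 = w 0" using u0 w0 by simp
      show "v' 0 = v 0" using v0 v_sq[of 0] w0 T by simp
    qed
  qed
  have unique: "u = w" if "profile u" and lim: "(u \<longlongrightarrow> 0) at_top \<or> (u \<longlongrightarrow> 0) at_bot" for u
  proof -
    obtain v' where u: "\<And>x. (u has_real_derivative v' x) (at x)"
      "\<And>x. (v' has_real_derivative h (u x)) (at x)" "\<And>x. 0 < u x" "\<And>x. u x \<le> u 0"
      using \<open>profile u\<close> unfolding profile_def by blast
    show ?thesis
      using lim
    proof
      assume "(u \<longlongrightarrow> 0) at_bot"
      then have "((\<lambda>x. u (- x)) \<longlongrightarrow> 0) at_top" by (simp add: filterlim_at_bot_mirror)
      then have "(\<lambda>x. u (- x)) = w"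
        using u by (intro unique_top[OF newton_reflect[OF u(1,2)]]) auto
      then have "u (- (- x)) = w (- x)" for x by metis
      then show ?thesis using w_even by auto
    qed (rule unique_top[OF u])
  qed
  show thesis
  proof (rule that[OF w_profile z_pos K c(1)])
    show "h (w z) = 0" using z s by (simp add: h_factor)
    show "w x \<le> K * exp (- c * \<bar>x\<bar>)" for x
      using decay_pos[of "\<bar>x\<bar>"] w_abs[of x] by simp
  qed (use h_w_neg h_w_pos unique in auto)
qed

end

section \<open>Inverting the Pucci operators\<close>

text \<open>Both Pucci operators and their inverses have this form, so one argument covers the two
  signs.\<close>

definition two_slope :: "real \<Rightarrow> real \<Rightarrow> real \<Rightarrow> real" where
  "two_slope a b s = (if 0 \<le> s then a * s else b * s)"

lemma pucci_eq_two_slope: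
  "pucci_plus lam Lam = two_slope Lam lam" "pucci_minus lam Lam = two_slope lam Lam"
  by (auto simp: fun_eq_iff pucci_plus_def pucci_minus_def two_slope_def)

lemma two_slope_eq_iff:
  assumes "0 < a" "0 < b"
  shows "two_slope a b s = t \<longleftrightarrow> s = two_slope (1 / a) (1 / b) t"
  using assms by (auto simp: two_slope_def field_simps zero_le_mult_iff)

lemma two_slope_mult: "0 < t \<Longrightarrow> two_slope a b (t * s) = t * two_slope a b s"
  by (auto simp: two_slope_def zero_le_mult_iff)

lemma two_slope_strict_mono:
  assumes "0 < a" "0 < b" "s < t"
  shows "two_slope a b s < two_slope a b t"
proof -
  have "b * s < 0" if "s < 0" using that assms by (simp add: mult_less_0_iff)
  moreover have "0 \<le> a * t" if "0 \<le> t" using that assms by simp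
  ultimately show ?thesis using assms by (auto simp: two_slope_def intro: less_le_trans)
qed

lemma two_slope_lipschitz:
  assumes "0 < a" "0 < b"
  shows "(max a b)-lipschitz_on UNIV (two_slope a b)"
proof (rule lipschitz_on_leI)
  fix s t :: real assume "s \<le> t"
  have "\<bar>two_slope a b t - two_slope a b s\<bar> = two_slope a b t - two_slope a b s"
    using two_slope_strict_mono[OF assms, of s t] \<open>s \<le> t\<close> by (cases "s = t") auto
  also have "\<dots> \<le> max a b * (t - s)"
  proof -
    have le: "a * r \<le> max a b * r" "b * r \<le> max a b * r" if "0 \<le> r" for r
      using that by (auto intro: mult_right_mono)
    consider "0 \<le> s" "0 \<le> t" | "s < 0" "0 \<le> t" | "s < 0" "t < 0"
      using \<open>s \<le> t\<close> by linarith
    then show ?thesis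
    proof cases
      \<comment> \<open>When the arguments have opposite signs, the increment is split at 0 and each
        piece is estimated with its own slope.\<close>
      case 2
      have "b * (- s) \<le> max a b * (- s)" by (rule le(2)) (use 2 in simp)
      moreover have "two_slope a b t - two_slope a b s = a * t + b * (- s)"
        using 2 by (simp add: two_slope_def)
      moreover have "max a b * (t - s) = max a b * t + max a b * (- s)"
        by (simp add: right_diff_distrib)
      ultimately show ?thesis using le(1)[OF 2(2)] by linarith
    qed (use le[of "t - s"] \<open>s \<le> t\<close> in \<open>simp_all add: two_slope_def right_diff_distrib\<close>)
  qed
  finally show "dist (two_slope a b s) (two_slope a b t) \<le> max a b * dist s t"
    using \<open>s \<le> t\<close> by (simp add: dist_real_def abs_minus_commute)
qed (use assms in auto)

text \<open>Continuity of the second derivative comes for free, as it equals \<open>h\<close>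
  composed with the continuous \<open>u\<close>.\<close>

lemma C2_solution_iff:
  assumes "continuous_on UNIV h"
  shows "C2_on_reals u \<and> (\<forall>x. deriv (deriv u) x = h (u x)) \<longleftrightarrow>
    (\<exists>v. \<forall>x. (u has_real_derivative v x) (at x) \<and> (v has_real_derivative h (u x)) (at x))"
    (is "?L \<longleftrightarrow> ?R")
proof
  assume L: ?L
  then have "u differentiable at x" "deriv u differentiable at x" for x
    by (auto simp: C2_on_reals_def C1_differentiable_on_eq)
  then have "(u has_real_derivative deriv u x) (at x)"
      "(deriv u has_real_derivative deriv (deriv u) x) (at x)" for x
    by (simp_all add: DERIV_deriv_iff_real_differentiable)
  then show ?R using L by auto
next
  assume ?R
  then obtain v where v: "\<And>x. (u has_real_derivative v x) (at x)"
    "\<And>x. (v has_real_derivative h (u x)) (at x)" by blast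
  have du: "deriv u = v" using v(1) by (auto intro: DERIV_imp_deriv)
  have "continuous_on UNIV u" "continuous_on UNIV v"
    using v by (auto intro!: continuous_at_imp_continuous_on DERIV_isCont)
  then have "C2_on_reals u"
    unfolding C2_on_reals_def du C1_differentiable_on_def
      has_real_derivative_iff_has_vector_derivative[symmetric]
    using v continuous_on_compose2[OF assms, of UNIV u]
    by (intro conjI exI[of _ v] exI[of _ "\<lambda>x. h (u x)"]) auto
  then show ?L using v(2) by (auto simp: du intro: DERIV_imp_deriv)
qed

section \<open>From the hypotheses on \<open>f\<close> to the scalar field equation\<close>

lemma C1_lipschitz_on_Icc:
  fixes f :: "real \<Rightarrow> real"
  assumes "f C1_differentiable_on UNIV"
  shows "\<exists>L. L-lipschitz_on {a..b} f"
proof -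
  obtain D where D: "\<And>x. (f has_real_derivative D x) (at x)" "continuous_on UNIV D"
    using assms by (auto simp: C1_differentiable_on_def has_real_derivative_iff_has_vector_derivative)
  have "compact (D ` {a..b})"
    by (intro compact_continuous_image continuous_on_subset[OF D(2)]) auto
  then obtain L where L: "0 < L" "\<And>x. x \<in> {a..b} \<Longrightarrow> \<bar>D x\<bar> \<le> L"
    by (auto dest!: compact_imp_bounded simp: bounded_pos)
  have "L-lipschitz_on {a..b} f"
  proof (rule bounded_derivative_imp_lipschitz)
    show "(f has_derivative (*) (D x)) (at x within {a..b})" for x
      using D(1)[of x] has_derivative_at_withinI by (auto simp: has_field_derivative_def)
    show "onorm ((*) (D x)) \<le> L" if "x \<in> {a..b}" for x
      by (rule onorm_le) (use L(2)[OF that] in \<open>auto simp: abs_mult intro: mult_right_mono\<close>)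
  qed (use L in auto)
  then show ?thesis by blast
qed

text \<open>Everything rests on the quotient \<open>f s / s\<close>: it increases strictly from its
  limit 0 at the origin to infinity, so \<open>V - f s / s\<close> decreases from \<open>V\<close>
  through zero. The bound \<open>V / a\<close> is the value of the inverse operator at
  \<open>V\<close>.\<close>

lemma scalar_field_two_slope:
  fixes f :: "real \<Rightarrow> real"
  assumes ab: "0 < a" "0 < b" and V: "0 < V"
    and f1: "f C1_differentiable_on UNIV"
    and f2: "((\<lambda>s. s powr (- 1 - \<eta>) * f s) \<longlongrightarrow> 0) (at_right 0)" "0 < \<eta>"
    and f3: "filterlim (\<lambda>s. f s / s) at_top at_top"
    and f4: "strict_mono_on {0<..} (\<lambda>s. f s / s)"
  shows "scalar_field (\<lambda>s. two_slope (1 / a) (1 / b) (V * s - f s))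
    (\<lambda>s. two_slope (1 / a) (1 / b) (V - f s / s)) (V / a)"
proof -
  have ab': "0 < 1 / a" "0 < 1 / b" using ab by auto
  note mono = two_slope_strict_mono[OF ab'] and lip = two_slope_lipschitz[OF ab']
  have f_cont: "continuous_on UNIV f"
    using f1 by (auto simp: C1_differentiable_on_eq intro!: continuous_at_imp_continuous_on
        differentiable_imp_continuous_within)
  have quot_less: "f s / s < f t / t" if "0 < s" "s < t" for s t
    using strict_mono_onD[OF f4, of s t] that by auto
  \<comment> \<open>For positive \<open>s\<close> this product is \<open>f s / s\<close>, so the
    superlinear vanishing of \<open>f\<close> at 0 gives the limit of the quotient.\<close>
  have "((\<lambda>s. s powr \<eta> * (s powr (- 1 - \<eta>) * f s)) \<longlongrightarrow> 0 * 0) (at_right 0)"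
  proof (intro tendsto_mult f2(1))
    have "((\<lambda>s. s powr \<eta>) \<longlongrightarrow> 0 powr \<eta>) (at_right 0)"
      using \<open>0 < \<eta>\<close>
      by (intro tendsto_powr' tendsto_ident_at tendsto_const)
        (auto simp: eventually_at_right_less intro: eventually_mono[OF eventually_at_right_less])
    then show "((\<lambda>s. s powr \<eta>) \<longlongrightarrow> 0) (at_right 0)"
      by simp
  qed
  moreover have "eventually (\<lambda>s. s powr \<eta> * (s powr (- 1 - \<eta>) * f s) = f s / s) (at_right 0)"
    using eventually_at_right_less[of "0::real"]
  proof eventually_elim
    case (elim s)
    have "s powr \<eta> * s powr (- 1 - \<eta>) = 1 / s"
      using elim by (simp add: powr_add[symmetric] powr_minus_divide)
    then show ?case by (simp add: mult.assoc[symmetric])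
  qed
  ultimately have lim0: "((\<lambda>s. f s / s) \<longlongrightarrow> 0) (at_right 0)"
    by (simp add: tendsto_cong)
  have quot_nonneg: "0 \<le> f s / s" if "0 < s" for s
  proof (rule tendsto_upperbound[OF lim0])
    show "eventually (\<lambda>t. f t / t \<le> f s / s) (at_right 0)"
      using eventually_at_right_real[OF that] by eventually_elim (auto intro: less_imp_le quot_less)
  qed simp
  show ?thesis
  proof
    show "continuous_on UNIV (\<lambda>s. two_slope (1 / a) (1 / b) (V * s - f s))"
      by (rule continuous_on_compose2[OF lipschitz_on_continuous_on[OF lip]])
        (auto intro!: continuous_intros f_cont)
    show "\<exists>L. L-lipschitz_on {0..c} (\<lambda>s. two_slope (1 / a) (1 / b) (V * s - f s))" for c
    proof -
      have "(\<lambda>s. V * s - f s) C1_differentiable_on UNIV"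
        using f1 by (intro derivative_intros) auto
      then obtain L where "L-lipschitz_on {0..c} (\<lambda>s. V * s - f s)"
        using C1_lipschitz_on_Icc by blast
      then show ?thesis using lipschitz_on_compose2[OF _ lipschitz_on_subset[OF lip]] by blast
    qed
    show "two_slope (1 / a) (1 / b) (V * s - f s) = s * two_slope (1 / a) (1 / b) (V - f s / s)"
      if "0 < s" for s
      using that by (simp add: two_slope_mult[symmetric] right_diff_distrib mult.commute)
    show "two_slope (1 / a) (1 / b) (V - f t / t) < two_slope (1 / a) (1 / b) (V - f s / s)"
      if "0 < s" "s < t" for s t
      using quot_less[OF that] by (intro mono) simp
    show "two_slope (1 / a) (1 / b) (V - f s / s) \<le> V / a" if "0 < s" for s
      using mono[of "V - f s / s" V] quot_nonneg[OF that] V by (cases "f s / s = 0") (auto simp: two_slope_def)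
    have "eventually (\<lambda>s. f s / s < V \<and> 0 < s) (at_right 0)"
      using order_tendstoD(2)[OF lim0 V] eventually_at_right_less by (rule eventually_conj)
    then show "\<exists>s>0. 0 < two_slope (1 / a) (1 / b) (V - f s / s)"
      using eventually_happens'[of "at_right (0::real)"] ab by (force simp: two_slope_def)
    have "eventually (\<lambda>s. V < f s / s \<and> 0 < s) at_top"
      using f3 by (intro eventually_conj eventually_gt_at_top) (simp add: filterlim_at_top_dense)
    then show "\<exists>s>0. two_slope (1 / a) (1 / b) (V - f s / s) < 0"
      using eventually_happens'[of "at_top :: real filter"] ab
      by (force simp: two_slope_def divide_less_0_iff)
  qed
qed

text \<open>Arbitrary positive slopes in either order are allowed, so that exchanging them exchanges
  the two signs.\<close>

lemma ground_state_two_slope: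
  fixes f :: "real \<Rightarrow> real"
  assumes ab: "0 < a" "0 < b" and "0 < V"
    and "f C1_differentiable_on UNIV"
    and "\<exists>\<eta>>0. ((\<lambda>s. s powr (- 1 - \<eta>) * f s) \<longlongrightarrow> 0) (at_right 0)"
    and "filterlim (\<lambda>s. f s / s) at_top at_top"
    and "strict_mono_on {0<..} (\<lambda>s. f s / s)"
  obtains w z c1 c2 where "0 < z" "0 < c1" "0 < c2"
    "\<forall>u. pos_solution_max_at_0 (two_slope a b) V f u \<and> (u \<longlongrightarrow> 0) at_infinity \<longleftrightarrow> u = w"
    "\<forall>x y. \<bar>x\<bar> < z \<and> z < \<bar>y\<bar> \<longrightarrow>
       deriv (deriv w) x < 0 \<and> deriv (deriv w) z = 0 \<and> 0 < deriv (deriv w) y"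
    "\<And>x. w x \<le> c1 * exp (- c2 * \<bar>x\<bar>)"
    "\<forall>u. pos_solution_max_at_0 (two_slope a b) V f u \<and>
       ((u \<longlongrightarrow> 0) at_top \<or> (u \<longlongrightarrow> 0) at_bot) \<longrightarrow> u = w"
proof -
  define h where "h s = two_slope (1 / a) (1 / b) (V * s - f s)" for s
  define p where "p s = two_slope (1 / a) (1 / b) (V - f s / s)" for s
  obtain \<eta> where "0 < \<eta>" "((\<lambda>s. s powr (- 1 - \<eta>) * f s) \<longlongrightarrow> 0) (at_right 0)"
    using assms(5) by blast
  then interpret scalar_field h p "V / a"
    unfolding h_def p_def using assms by (intro scalar_field_two_slope)
  have eq_iff: "- two_slope a b d + V * t = f t \<longleftrightarrow> d = h t" for d t
    using two_slope_eq_iff[OF ab, of d "V * t - f t"] by (auto simp: h_def)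
  have sol_iff: "pos_solution_max_at_0 (two_slope a b) V f u \<longleftrightarrow> profile u" for u
    using C2_solution_iff[OF h_cont, of u]
    unfolding pos_solution_max_at_0_def profile_def eq_iff by metis
  obtain w z c1 c2 where w: "profile w" "0 < z" "0 < c1" "0 < c2"
    "\<And>x. \<bar>x\<bar> < z \<Longrightarrow> h (w x) < 0" "h (w z) = 0" "\<And>x. z < \<bar>x\<bar> \<Longrightarrow> 0 < h (w x)"
    "\<And>x. w x \<le> c1 * exp (- c2 * \<bar>x\<bar>)"
    "\<And>u. profile u \<Longrightarrow> (u \<longlongrightarrow> 0) at_top \<or> (u \<longlongrightarrow> 0) at_bot \<Longrightarrow> u = w"
    using profile_exists_unique by blast
  have w'': "deriv (deriv w) x = h (w x)" for x
    using w(1) unfolding sol_iff[symmetric] pos_solution_max_at_0_def eq_iff by blast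
  \<comment> \<open>The exponential bound is what shows that \<open>w\<close> satisfies the
    two-sided condition at infinity.\<close>
  have "((\<lambda>x. c1 * exp (- c2 * norm x)) \<longlongrightarrow> 0) (at_infinity :: real filter)"
  proof -
    have "filterlim (\<lambda>x::real. c2 * norm x) at_top at_infinity"
      by (rule filterlim_tendsto_pos_mult_at_top[OF tendsto_const \<open>0 < c2\<close> filterlim_norm_at_top])
    then have "((\<lambda>x::real. exp (- (c2 * norm x))) \<longlongrightarrow> 0) at_infinity"
      by (intro filterlim_compose[OF exp_at_bot]) (simp add: filterlim_uminus_at_bot)
    then show ?thesis by (auto intro: tendsto_mult_right_zero)
  qed
  then have w_lim: "(w \<longlongrightarrow> 0) at_infinity"
  proof (rule tendsto_sandwich[OF _ _ tendsto_const, rotated 2])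
    show "eventually (\<lambda>x. 0 \<le> w x) at_infinity"
      using w(1) by (auto simp: profile_def intro!: always_eventually less_imp_le)
  qed (use w(8) in auto)
  show thesis
  proof (rule that[OF w(2-4)])
    show "\<forall>u. pos_solution_max_at_0 (two_slope a b) V f u \<and> (u \<longlongrightarrow> 0) at_infinity \<longleftrightarrow> u = w"
      using w(1,9) w_lim tendsto_mono[OF at_top_le_at_infinity] unfolding sol_iff by blast
  qed (use w(5-9) w'' sol_iff in auto)
qed

section \<open>The two signs with common decay constants\<close>

theorem proposition2p1:
  fixes lam Lam V :: real and f :: "real \<Rightarrow> real"
  assumes "0 < lam" and "lam \<le> Lam" and "V > 0"
    and f1: "f C1_differentiable_on UNIV" "\<forall>s\<le>0. f s = 0"
    and f2: "\<exists>\<eta>>0. ((\<lambda>s. s powr (- 1 - \<eta>) * f s) \<longlongrightarrow> 0) (at_right 0)"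
    and f3: "filterlim (\<lambda>s. f s / s) at_top at_top"
      "\<exists>fbar :: real \<Rightarrow> real. \<forall>K. compact K \<and> K \<subseteq> {0<..1} \<longrightarrow>
         uniform_limit K (\<lambda>s \<theta>. f (\<theta> * s) / f s) fbar at_top"
    and f4: "strict_mono_on {0<..} (\<lambda>s. f s / s)"
  shows "\<exists>(\<omega>p :: real \<Rightarrow> real) (\<omega>m :: real \<Rightarrow> real) (zp :: real) (zm :: real) (c1 :: real) (c2 :: real).
      zp > 0 \<and> zm > 0 \<and> c1 > 0 \<and> c2 > 0 \<and>
      (\<forall>u. pos_solution_max_at_0 (pucci_plus lam Lam) V f u \<and> (u \<longlongrightarrow> 0) at_infinity
        \<longleftrightarrow> u = \<omega>p) \<and>
      (\<forall>u. pos_solution_max_at_0 (pucci_minus lam Lam) V f u \<and> (u \<longlongrightarrow> 0) at_infinity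
        \<longleftrightarrow> u = \<omega>m) \<and>
      (\<forall>x y. \<bar>x\<bar> < zp \<and> zp < \<bar>y\<bar> \<longrightarrow>
        deriv (deriv \<omega>p) x < 0 \<and> deriv (deriv \<omega>p) zp = 0 \<and> 0 < deriv (deriv \<omega>p) y) \<and>
      (\<forall>x y. \<bar>x\<bar> < zm \<and> zm < \<bar>y\<bar> \<longrightarrow>
        deriv (deriv \<omega>m) x < 0 \<and> deriv (deriv \<omega>m) zm = 0 \<and> 0 < deriv (deriv \<omega>m) y) \<and>
      (\<forall>x. \<omega>p x \<le> c1 * exp (- c2 * \<bar>x\<bar>)) \<and>
      (\<forall>x. \<omega>m x \<le> c1 * exp (- c2 * \<bar>x\<bar>)) \<and>
      (\<forall>u. pos_solution_max_at_0 (pucci_plus lam Lam) V f u \<and>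
          ((u \<longlongrightarrow> 0) at_top \<or> (u \<longlongrightarrow> 0) at_bot)
        \<longrightarrow> u = \<omega>p) \<and>
      (\<forall>u. pos_solution_max_at_0 (pucci_minus lam Lam) V f u \<and>
          ((u \<longlongrightarrow> 0) at_top \<or> (u \<longlongrightarrow> 0) at_bot)
        \<longrightarrow> u = \<omega>m)"
proof -
  have Lam: "0 < Lam" using \<open>0 < lam\<close> \<open>lam \<le> Lam\<close> by simp
  note hyps = \<open>V > 0\<close> f1(1) f2 f3(1) f4
  obtain wp zp c1 c2 where p: "0 < zp" "0 < c1" "0 < c2"
    "\<forall>u. pos_solution_max_at_0 (pucci_plus lam Lam) V f u \<and> (u \<longlongrightarrow> 0) at_infinity \<longleftrightarrow> u = wp"
    "\<forall>x y. \<bar>x\<bar> < zp \<and> zp < \<bar>y\<bar> \<longrightarrow>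
       deriv (deriv wp) x < 0 \<and> deriv (deriv wp) zp = 0 \<and> 0 < deriv (deriv wp) y"
    "\<And>x. wp x \<le> c1 * exp (- c2 * \<bar>x\<bar>)"
    "\<forall>u. pos_solution_max_at_0 (pucci_plus lam Lam) V f u \<and>
       ((u \<longlongrightarrow> 0) at_top \<or> (u \<longlongrightarrow> 0) at_bot) \<longrightarrow> u = wp"
    unfolding pucci_eq_two_slope by (rule ground_state_two_slope[OF Lam \<open>0 < lam\<close> hyps]) blast
  obtain wm zm d1 d2 where m: "0 < zm" "0 < d1" "0 < d2"
    "\<forall>u. pos_solution_max_at_0 (pucci_minus lam Lam) V f u \<and> (u \<longlongrightarrow> 0) at_infinity \<longleftrightarrow> u = wm"
    "\<forall>x y. \<bar>x\<bar> < zm \<and> zm < \<bar>y\<bar> \<longrightarrow>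
       deriv (deriv wm) x < 0 \<and> deriv (deriv wm) zm = 0 \<and> 0 < deriv (deriv wm) y"
    "\<And>x. wm x \<le> d1 * exp (- d2 * \<bar>x\<bar>)"
    "\<forall>u. pos_solution_max_at_0 (pucci_minus lam Lam) V f u \<and>
       ((u \<longlongrightarrow> 0) at_top \<or> (u \<longlongrightarrow> 0) at_bot) \<longrightarrow> u = wm"
    unfolding pucci_eq_two_slope by (rule ground_state_two_slope[OF \<open>0 < lam\<close> Lam hyps]) blast
  \<comment> \<open>Each sign comes with its own constants; the larger prefactor and the slower rate
    serve both.\<close>
  have weaken: "c * exp (- d * \<bar>x\<bar>) \<le> max c1 d1 * exp (- min c2 d2 * \<bar>x\<bar>)"
    if "c \<le> max c1 d1" "min c2 d2 \<le> d" for c d x :: real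
    using that p(2) by (intro mult_mono) (auto intro: mult_right_mono)
  have bounds: "wp x \<le> max c1 d1 * exp (- min c2 d2 * \<bar>x\<bar>)"
    "wm x \<le> max c1 d1 * exp (- min c2 d2 * \<bar>x\<bar>)" for x
    by (rule order_trans[OF p(6) weaken], simp, simp) (rule order_trans[OF m(6) weaken], simp, simp)
  have "0 < max c1 d1" "0 < min c2 d2" using p m by auto
  with p(1,4,5,7) m(1,4,5,7) show ?thesis
    by (intro exI[of _ wp] exI[of _ wm] exI[of _ zp] exI[of _ zm] exI[of _ "max c1 d1"]
        exI[of _ "min c2 d2"] conjI allI[OF bounds(1)] allI[OF bounds(2)])
qed

end
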